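(* Let $(F_n)$ be a sequence of APN functions $F_n\colon\mathbb F_2^n\to\mathbb F_2^n$, indexed by odd dimensions $n$ tending to infinity, let $N=2^n$, and let $q_n$ be the number of nonplateaued nonzero components of $F_n$. Then \[ \mathcal L(F_n)/N\to1\quad\Longrightarrow\quad q_n/N\to1 . \]
   Context: A function $F\colon\mathbb F_2^n\to\mathbb F_2^n$ is almost perfect nonlinear (APN) if for every $h\in\mathbb F_2^n\setminus\{0\}$ and every $y\in\mathbb F_2^n$ the equation $F(x+h)+F(x)=y$ has at most two solutions $x\in\mathbb F_2^n$. For $b\in\mathbb F_2^n$ let $f_b=b\cdot F\colon\mathbb F_2^n\to\mathbb F_2$, where $\cdot$ is the usual dot product over $\mathbb F_2$. For a Boolean function $f\colon\mathbb F_2^n\to\mathbb F_2$ the Walsh transform is $W_f(a)=\sum_{x\in\mathbb F_2^n}(-1)^{f(x)+a\cdot x}$ for $a\in\mathbb F_2^n$. The linearity of $F$ is $\mathcal L(F)=\max\{|W_{f_b}(a)| : a\in\mathbb F_2^n,\ b\in\mathbb F_2^n\setminus\{0\}\}$. A Boolean function $f$ is plateaued if there is $\lambda>0$ such that $W_f(a)\in\{0,\lambda,-\lambda\}$ for all $a\in\mathbb F_2^n$ (affine Boolean functions are included). The number of nonplateaued nonzero components of $F$ is $|\{b\in\mathbb F_2^n\setminus\{0\}: b\cdot F\text{ is not plateaued}\}|$. *)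

theory Defs
  imports Complex_Main "HOL-Library.Z2" "Jordan_Normal_Form.Matrix"
begin

text \<open>
  The field with two elements is \<^typ>\<open>bit\<close>, and its \<open>n\<close>-dimensional coordinate space is
  \<open>carrier_vec n\<close>. Functions on that space are total functions on \<^typ>\<open>bit vec\<close> whose
  values outside \<open>carrier_vec n\<close> are irrelevant.
\<close>

abbreviation F2 :: "nat \<Rightarrow> bit vec set" where
  "F2 n \<equiv> carrier_vec n"

definition APN :: "nat \<Rightarrow> (bit vec \<Rightarrow> bit vec) \<Rightarrow> bool" where
  "APN n F \<longleftrightarrow> F \<in> F2 n \<rightarrow> F2 n \<and>
     (\<forall>h\<in>F2 n - {0\<^sub>v n}. \<forall>y\<in>F2 n. card {x \<in> F2 n. F (x + h) + F x = y} \<le> 2)"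

definition component :: "bit vec \<Rightarrow> (bit vec \<Rightarrow> bit vec) \<Rightarrow> bit vec \<Rightarrow> bit" where
  "component b F x = b \<bullet> F x"

definition walsh :: "nat \<Rightarrow> (bit vec \<Rightarrow> bit) \<Rightarrow> bit vec \<Rightarrow> int" where
  "walsh n f a = (\<Sum>x\<in>F2 n. (- 1) ^ of_bit (f x + a \<bullet> x))"

definition linearity :: "nat \<Rightarrow> (bit vec \<Rightarrow> bit vec) \<Rightarrow> int" where
  "linearity n F = Max {\<bar>walsh n (component b F) a\<bar> | a b. a \<in> F2 n \<and> b \<in> F2 n - {0\<^sub>v n}}"

definition plateaued :: "nat \<Rightarrow> (bit vec \<Rightarrow> bit) \<Rightarrow> bool" where
  "plateaued n f \<longleftrightarrow>
     (\<exists>l::real. l > 0 \<and> (\<forall>a\<in>F2 n. real_of_int (walsh n f a) \<in> {0, l, - l}))"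

definition num_nonplateaued :: "nat \<Rightarrow> (bit vec \<Rightarrow> bit vec) \<Rightarrow> nat" where
  "num_nonplateaued n F = card {b \<in> F2 n - {0\<^sub>v n}. \<not> plateaued n (component b F)}"

end

theory Submission
  imports Defs "HOL-Real_Asymp.Real_Asymp" "HOL-Computational_Algebra.Primes"
begin

text \<open>
  Write \<open>N = 2 ^ n\<close> and let \<open>M b\<close> be the sum of the fourth powers of the Walsh coefficients of
  the component with index \<open>b\<close>. The proof weighs three facts about \<open>M\<close> against each other.

  First, an APN function satisfies \<open>(\<Sum>b\<noteq>0. M b) \<le> 2 * N ^ 3 * (N - 1)\<close>: up to a factor \<open>N\<^sup>2\<close>, the
  sum of \<open>M\<close> over all \<open>b\<close> is the sum of the squares of the numbers of solutions \<open>x\<close> of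
  \<open>F (x + h) + F x = y\<close>, and these numbers are at most 2 for \<open>h \<noteq> 0\<close>
  (lemma \<open>APN_fourth_moment_le\<close>). Second, \<open>M b \<ge> N ^ 3\<close> for every \<open>b\<close>, and in odd dimension
  \<open>M b \<ge> 2 * N ^ 3\<close> if the component is plateaued, because its amplitude is a power of 2 whose
  square is at least the odd power \<open>N\<close> of 2 and hence at least \<open>2 * N\<close>
  (lemmas \<open>fourth_moment_ge\<close> and \<open>plateaued_fourth_moment_ge\<close>). Third, the component attaining
  the linearity \<open>L\<close> has \<open>M b \<ge> L ^ 4\<close>.

  So when \<open>L\<close> is close to \<open>N\<close>, this one component uses up about \<open>N ^ 4\<close>, half of the
  total. What remains is just about \<open>N ^ 3\<close> for each of the other components, so that almost
  none of them can afford to be plateaued. Quantitatively, the number \<open>q\<close> of nonplateaued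
  components satisfies \<open>(L / N) ^ 4 - 2 / N \<le> q / N \<le> 1\<close>.
\<close>

section \<open>Binary vectors\<close>

text \<open>Sums of bits must keep their form here, because the additivity of characters matches on \<open>+\<close>.\<close>
declare add_bit_eq_xor [simp del]

lemma F2_eq_image_lists: "F2 n = vec_of_list ` {xs. set xs \<subseteq> UNIV \<and> length xs = n}"
proof (intro subset_antisym subsetI)
  fix v :: "bit vec" assume "v \<in> F2 n"
  then have "length (list_of_vec v) = n"
    by simp
  then show "v \<in> vec_of_list ` {xs. set xs \<subseteq> UNIV \<and> length xs = n}"
    by (intro image_eqI[of _ _ "list_of_vec v"]) (simp_all add: vec_list)
next
  fix v :: "bit vec" assume "v \<in> vec_of_list ` {xs. set xs \<subseteq> UNIV \<and> length xs = n}"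
  then show "v \<in> F2 n"
    by (auto intro!: carrier_vecI)
qed

lemma UNIV_bit: "(UNIV :: bit set) = {0, 1}"
proof -
  have "x \<in> {0, 1}" for x :: bit
    by (cases x) auto
  then show ?thesis by blast
qed

lemma finite_F2 [simp]: "finite (F2 n)"
  unfolding F2_eq_image_lists by (intro finite_imageI finite_lists_length_eq) (simp add: UNIV_bit)

lemma card_F2 [simp]: "card (F2 n) = 2 ^ n"
proof -
  have "inj_on vec_of_list {xs :: bit list. set xs \<subseteq> UNIV \<and> length xs = n}"
    by (rule inj_onI) (metis list_vec)
  then have "card (F2 n) = card {xs :: bit list. set xs \<subseteq> UNIV \<and> length xs = n}"
    unfolding F2_eq_image_lists by (rule card_image)
  also have "\<dots> = 2 ^ n"
    by (subst card_lists_length_eq) (simp_all add: UNIV_bit numeral_2_eq_2)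
  finally show ?thesis .
qed

lemma bit_add_self [simp]: "(c :: bit) + c = 0"
  by (cases c) simp_all

lemma add_self_F2 [simp]: "x \<in> F2 n \<Longrightarrow> x + x = 0\<^sub>v n"
  by (intro eq_vecI) auto

lemma add_add_cancel_F2 [simp]:
  assumes "x \<in> F2 n" "h \<in> F2 n"
  shows "x + (x + h) = h" "h + x + x = h"
proof -
  show "x + (x + h) = h"
    using assms assoc_add_vec[of x n x h] by simp
  show "h + x + x = h"
    using assms assoc_add_vec[of h n x x] by simp
qed

lemma sum_translate_F2: "h \<in> F2 n \<Longrightarrow> (\<Sum>x\<in>F2 n. g (h + x)) = (\<Sum>x\<in>F2 n. g x)"
  by (rule sum.reindex_bij_witness[where i = "\<lambda>x. h + x" and j = "\<lambda>x. h + x"]) auto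

section \<open>Fourier analysis on binary vectors\<close>

definition sgn_bit :: "bit \<Rightarrow> int" where
  "sgn_bit c = (- 1) ^ of_bit c"

definition fourier :: "nat \<Rightarrow> (bit vec \<Rightarrow> int) \<Rightarrow> bit vec \<Rightarrow> int" where
  "fourier n g a = (\<Sum>x\<in>F2 n. g x * sgn_bit (a \<bullet> x))"

definition autocorr :: "nat \<Rightarrow> (bit vec \<Rightarrow> int) \<Rightarrow> bit vec \<Rightarrow> int" where
  "autocorr n g h = (\<Sum>x\<in>F2 n. g x * g (x + h))"

lemma sgn_bit_0 [simp]: "sgn_bit 0 = 1"
  and sgn_bit_1 [simp]: "sgn_bit 1 = - 1"
  by (simp_all add: sgn_bit_def)

lemma sgn_bit_add: "sgn_bit (c + d) = sgn_bit c * sgn_bit d"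
  by (cases c; cases d) simp_all

lemma sgn_bit_mult_self [simp]: "sgn_bit c * sgn_bit c = 1"
  by (cases c) simp_all

text \<open>
  If \<open>x\<close> has a coordinate equal to 1, translating \<open>a\<close> by the corresponding unit vector changes
  the sign of every summand.
\<close>
lemma sum_characters:
  assumes x: "x \<in> F2 n"
  shows "(\<Sum>a\<in>F2 n. sgn_bit (a \<bullet> x)) = (if x = 0\<^sub>v n then 2 ^ n else 0)"
proof (cases "x = 0\<^sub>v n")
  case True
  then show ?thesis by simp
next
  case False
  then obtain i where i: "i < n" "x $ i = 1"
    using x by (metis bit_not_zero_iff carrier_vecD eq_vecI index_zero_vec)
  let ?S = "\<Sum>a\<in>F2 n. sgn_bit (a \<bullet> x)"
  have "?S = (\<Sum>a\<in>F2 n. sgn_bit ((unit_vec n i + a) \<bullet> x))"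
    by (rule sum_translate_F2[symmetric]) simp
  also have "\<dots> = (\<Sum>a\<in>F2 n. - sgn_bit (a \<bullet> x))"
    using x i by (intro sum.cong) (auto simp: add_scalar_prod_distrib[of _ n] sgn_bit_add)
  finally show ?thesis
    using False by (simp add: sum_negf)
qed

lemma sum_fourier: "(\<Sum>a\<in>F2 n. fourier n g a) = 2 ^ n * g (0\<^sub>v n)"
proof -
  have "(\<Sum>a\<in>F2 n. fourier n g a) = (\<Sum>x\<in>F2 n. g x * (\<Sum>a\<in>F2 n. sgn_bit (a \<bullet> x)))"
    unfolding fourier_def sum_distrib_left by (rule sum.swap)
  also have "\<dots> = (\<Sum>x\<in>F2 n. if x = 0\<^sub>v n then 2 ^ n * g x else 0)"
    by (intro sum.cong) (auto simp: sum_characters)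
  finally show ?thesis by simp
qed

lemma fourier_autocorr:
  assumes a: "a \<in> F2 n"
  shows "fourier n (autocorr n g) a = (fourier n g a)\<^sup>2"
proof -
  have "(fourier n g a)\<^sup>2
      = (\<Sum>x\<in>F2 n. \<Sum>y\<in>F2 n. (g x * sgn_bit (a \<bullet> x)) * (g y * sgn_bit (a \<bullet> y)))"
    by (simp add: fourier_def power2_eq_square sum_product)
  also have "\<dots> = (\<Sum>x\<in>F2 n. \<Sum>h\<in>F2 n. (g x * sgn_bit (a \<bullet> x)) * (g (x + h) * sgn_bit (a \<bullet> (x + h))))"
    by (intro sum.cong refl sum_translate_F2[symmetric])
  also have "\<dots> = (\<Sum>x\<in>F2 n. \<Sum>h\<in>F2 n. g x * g (x + h) * sgn_bit (a \<bullet> h))"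
    using a by (intro sum.cong refl) (auto simp: scalar_prod_add_distrib[of _ n] sgn_bit_add algebra_simps)
  also have "\<dots> = fourier n (autocorr n g) a"
    unfolding fourier_def autocorr_def sum_distrib_right by (rule sum.swap)
  finally show ?thesis ..
qed

lemma parseval: "(\<Sum>a\<in>F2 n. (fourier n g a)\<^sup>2) = 2 ^ n * (\<Sum>x\<in>F2 n. (g x)\<^sup>2)"
proof -
  have "(\<Sum>a\<in>F2 n. (fourier n g a)\<^sup>2) = (\<Sum>a\<in>F2 n. fourier n (autocorr n g) a)"
    by (simp add: fourier_autocorr)
  also have "\<dots> = 2 ^ n * (\<Sum>x\<in>F2 n. (g x)\<^sup>2)"
    by (simp add: sum_fourier autocorr_def power2_eq_square)
  finally show ?thesis .
qed

lemma fourier_fourth_moment: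
  "(\<Sum>a\<in>F2 n. fourier n g a ^ 4) = 2 ^ n * (\<Sum>h\<in>F2 n. (autocorr n g h)\<^sup>2)"
proof -
  have "(\<Sum>a\<in>F2 n. fourier n g a ^ 4) = (\<Sum>a\<in>F2 n. (fourier n (autocorr n g) a)\<^sup>2)"
    by (simp add: fourier_autocorr flip: power_mult)
  then show ?thesis
    by (simp add: parseval)
qed

section \<open>Fourth moments of Walsh coefficients\<close>

definition fourth_moment :: "nat \<Rightarrow> (bit vec \<Rightarrow> bit) \<Rightarrow> int" where
  "fourth_moment n f = (\<Sum>a\<in>F2 n. walsh n f a ^ 4)"

lemma walsh_eq_fourier: "walsh n f a = fourier n (\<lambda>x. sgn_bit (f x)) a"
  unfolding walsh_def fourier_def sgn_bit_add[symmetric] unfolding sgn_bit_def ..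

lemma fourth_moment_eq:
  "fourth_moment n f = 2 ^ n * (\<Sum>h\<in>F2 n. (autocorr n (\<lambda>x. sgn_bit (f x)) h)\<^sup>2)"
  by (simp add: fourth_moment_def walsh_eq_fourier fourier_fourth_moment)

lemma walsh_parseval: "(\<Sum>a\<in>F2 n. (walsh n f a)\<^sup>2) = (2 ^ n)\<^sup>2"
  unfolding walsh_eq_fourier parseval by (simp add: power2_eq_square)

lemma walsh_le_fourth_moment:
  assumes "a \<in> F2 n"
  shows "walsh n f a ^ 4 \<le> fourth_moment n f"
  unfolding fourth_moment_def using assms by (intro member_le_sum) auto

text \<open>
  The moment is \<open>2 ^ n\<close> times the sum of the squared autocorrelations of the sign function, and
  the autocorrelation at 0 is already \<open>2 ^ n\<close>.
\<close>
lemma fourth_moment_ge: "(2 ^ n) ^ 3 \<le> fourth_moment n f"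
proof -
  let ?r = "autocorr n (\<lambda>x. sgn_bit (f x))"
  have "(?r (0\<^sub>v n))\<^sup>2 \<le> (\<Sum>h\<in>F2 n. (?r h)\<^sup>2)"
    by (intro member_le_sum) auto
  moreover have "?r (0\<^sub>v n) = 2 ^ n"
    by (simp add: autocorr_def)
  ultimately show ?thesis
    by (simp add: fourth_moment_eq power3_eq_cube power2_eq_square)
qed

text \<open>
  By Parseval, the amplitude \<open>m\<close> and the number \<open>k\<close> of nonzero Walsh coefficients satisfy
  \<open>k * m\<^sup>2 = 2 ^ (2 * n)\<close>, so \<open>m\<close> is a power of 2; as \<open>k \<le> 2 ^ n\<close>, the square \<open>m\<^sup>2\<close> is an even
  power of 2 that is at least \<open>2 ^ n\<close>, which for odd \<open>n\<close> forces \<open>m\<^sup>2 \<ge> 2 ^ (n + 1)\<close>.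
\<close>
lemma plateaued_fourth_moment_ge:
  assumes "odd n" and pl: "plateaued n f"
  shows "2 * (2 ^ n) ^ 3 \<le> fourth_moment n f"
proof -
  obtain l :: real where l: "l > 0" "\<And>a. a \<in> F2 n \<Longrightarrow> real_of_int (walsh n f a) \<in> {0, l, - l}"
    using pl unfolding plateaued_def by blast
  have "\<exists>a\<in>F2 n. walsh n f a \<noteq> 0"
  proof (rule ccontr)
    assume "\<not> ?thesis"
    then have "(\<Sum>a\<in>F2 n. (walsh n f a)\<^sup>2) = 0" by simp
    then show False by (simp add: walsh_parseval)
  qed
  then obtain a0 where a0: "a0 \<in> F2 n" "walsh n f a0 \<noteq> 0" by blast
  define m where "m = nat \<bar>walsh n f a0\<bar>"
  have lm: "l = real m"
    using l(1) l(2)[OF a0(1)] a0(2) by (auto simp: m_def)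
  have sq: "(walsh n f a)\<^sup>2 = (if walsh n f a \<noteq> 0 then int (m\<^sup>2) else 0)" if "a \<in> F2 n" for a
  proof (cases "walsh n f a = 0")
    case False
    then have "\<bar>real_of_int (walsh n f a)\<bar> = real m"
      using l(2)[OF that] by (auto simp: lm)
    then have "\<bar>walsh n f a\<bar> = int m" by linarith
    then have "\<bar>walsh n f a\<bar>\<^sup>2 = int (m\<^sup>2)" by simp
    then show ?thesis using False by simp
  qed simp
  define k where "k = card {a \<in> F2 n. walsh n f a \<noteq> 0}"
  have "(2 ^ n)\<^sup>2 = (\<Sum>a\<in>F2 n. if walsh n f a \<noteq> 0 then int (m\<^sup>2) else 0)"
    unfolding walsh_parseval[of n f, symmetric] by (intro sum.cong sq refl)
  also have "\<dots> = int (k * m\<^sup>2)"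
    by (simp add: k_def flip: sum.inter_filter)
  finally have km_int: "int (k * m\<^sup>2) = (2 ^ n)\<^sup>2" ..
  have "int (k * m\<^sup>2) = int ((2 ^ n)\<^sup>2)"
    using km_int by simp
  then have km: "k * m\<^sup>2 = (2 ^ n)\<^sup>2"
    by (simp only: of_nat_eq_iff)
  have "m dvd 2 ^ (n * 2)"
    unfolding power_mult km[symmetric] by (simp add: power2_eq_square)
  then obtain i where i: "m = 2 ^ i"
    using divides_primepow_nat[OF two_is_prime_nat] by blast
  have "k \<le> card (F2 n)"
    unfolding k_def by (intro card_mono) auto
  then have "k \<le> 2 ^ n" by simp
  then have "(2 ^ n)\<^sup>2 \<le> 2 ^ n * m\<^sup>2"
    unfolding km[symmetric] by (rule mult_right_mono) simp
  then have "(2::nat) ^ n \<le> 2 ^ (2 * i)"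
    by (simp add: i power2_eq_square mult_2 power_add)
  then have "n \<le> 2 * i" by simp
  with \<open>odd n\<close> have "Suc n \<le> 2 * i"
    by (metis Suc_leI dvd_triv_left le_neq_implies_less)
  then have "(2::int) ^ Suc n \<le> 2 ^ (2 * i)"
    by (rule power_increasing) simp
  then have m2: "2 * 2 ^ n \<le> int (m\<^sup>2)"
    by (simp add: i power_even_eq)
  have "fourth_moment n f = (\<Sum>a\<in>F2 n. int (m\<^sup>2) * (walsh n f a)\<^sup>2)"
    unfolding fourth_moment_def
  proof (intro sum.cong refl)
    fix a assume "a \<in> F2 n"
    then have "(walsh n f a)\<^sup>2 * (walsh n f a)\<^sup>2 = int (m\<^sup>2) * (walsh n f a)\<^sup>2"
      by (cases "walsh n f a = 0") (simp_all only: sq if_True if_False mult_zero_right power_zero_numeral not_False_eq_True simp_thms)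
    then show "walsh n f a ^ 4 = int (m\<^sup>2) * (walsh n f a)\<^sup>2"
      by (simp flip: power_add)
  qed
  also have "\<dots> = int (m\<^sup>2) * (2 ^ n)\<^sup>2"
    by (simp add: walsh_parseval flip: sum_distrib_left)
  also have "\<dots> \<ge> (2 * 2 ^ n) * (2 ^ n)\<^sup>2"
    by (rule mult_right_mono[OF m2]) simp
  finally show ?thesis
    by (simp add: power3_eq_cube power2_eq_square)
qed

lemma fourth_moment_component_zero:
  assumes "F \<in> F2 n \<rightarrow> F2 n"
  shows "(2 ^ n) ^ 4 \<le> fourth_moment n (component (0\<^sub>v n) F)"
proof -
  have "walsh n (component (0\<^sub>v n) F) (0\<^sub>v n) = (\<Sum>x\<in>F2 n. 1)"
    unfolding walsh_def component_def using funcset_mem[OF assms] by (intro sum.cong) auto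
  then show ?thesis
    using walsh_le_fourth_moment[of "0\<^sub>v n" n "component (0\<^sub>v n) F"] by simp
qed

section \<open>The fourth moments of an APN function\<close>

text \<open>
  For fixed \<open>h\<close>, the autocorrelations of the components at \<open>h\<close> form the Fourier transform of
  the distribution of the derivative of \<open>F\<close> in direction \<open>h\<close>.
\<close>
lemma autocorr_component:
  assumes F: "F \<in> F2 n \<rightarrow> F2 n" and "b \<in> F2 n" "h \<in> F2 n"
  shows "autocorr n (\<lambda>x. sgn_bit (component b F x)) h
    = fourier n (\<lambda>y. int (card {x \<in> F2 n. F (x + h) + F x = y})) b"
proof -
  have "autocorr n (\<lambda>x. sgn_bit (component b F x)) h
      = (\<Sum>x\<in>F2 n. sgn_bit (b \<bullet> (F (x + h) + F x)))"
    unfolding autocorr_def component_def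
  proof (intro sum.cong refl)
    fix x assume "x \<in> F2 n"
    then have "F x \<in> F2 n" "F (x + h) \<in> F2 n"
      using F \<open>h \<in> F2 n\<close> by auto
    then show "sgn_bit (b \<bullet> F x) * sgn_bit (b \<bullet> F (x + h)) = sgn_bit (b \<bullet> (F (x + h) + F x))"
      using \<open>b \<in> F2 n\<close> by (simp add: scalar_prod_add_distrib[of _ n] sgn_bit_add mult.commute)
  qed
  also have "\<dots> = (\<Sum>y\<in>F2 n. int (card {x \<in> F2 n. F (x + h) + F x = y}) * sgn_bit (b \<bullet> y))"
    using F \<open>h \<in> F2 n\<close> by (intro sum_fun_comp) (auto intro!: add_carrier_vec)
  finally show ?thesis
    by (simp add: fourier_def)
qed

lemma sum_fourth_moments:
  assumes F: "F \<in> F2 n \<rightarrow> F2 n"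
  shows "(\<Sum>b\<in>F2 n. fourth_moment n (component b F))
    = (2 ^ n)\<^sup>2 * (\<Sum>h\<in>F2 n. \<Sum>y\<in>F2 n. (int (card {x \<in> F2 n. F (x + h) + F x = y}))\<^sup>2)"
proof -
  let ?c = "\<lambda>h y. int (card {x \<in> F2 n. F (x + h) + F x = y})"
  have "(\<Sum>b\<in>F2 n. fourth_moment n (component b F))
      = 2 ^ n * (\<Sum>b\<in>F2 n. \<Sum>h\<in>F2 n. (fourier n (?c h) b)\<^sup>2)"
    by (simp add: fourth_moment_eq autocorr_component[OF F] sum_distrib_left)
  also have "\<dots> = 2 ^ n * (\<Sum>h\<in>F2 n. \<Sum>b\<in>F2 n. (fourier n (?c h) b)\<^sup>2)"
    by (intro arg_cong[of _ _ "(*) (2 ^ n)"] sum.swap)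
  also have "\<dots> = (2 ^ n)\<^sup>2 * (\<Sum>h\<in>F2 n. \<Sum>y\<in>F2 n. (?c h y)\<^sup>2)"
    unfolding parseval sum_distrib_left[symmetric] by (simp add: power2_eq_square)
  finally show ?thesis .
qed

lemma APN_sum_derivative_counts_le:
  assumes "APN n F" and h: "h \<in> F2 n"
  shows "(\<Sum>y\<in>F2 n. (int (card {x \<in> F2 n. F (x + h) + F x = y}))\<^sup>2)
    \<le> (if h = 0\<^sub>v n then (2 ^ n)\<^sup>2 else 2 * 2 ^ n)"
proof -
  have F: "F \<in> F2 n \<rightarrow> F2 n"
    using assms by (simp add: APN_def)
  let ?c = "\<lambda>y. card {x \<in> F2 n. F (x + h) + F x = y}"
  define B :: int where "B = (if h = 0\<^sub>v n then 2 ^ n else 2)"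
  have B: "int (?c y) \<le> B" if "y \<in> F2 n" for y
  proof (cases "h = 0\<^sub>v n")
    case True
    have "?c y \<le> card (F2 n)"
      by (intro card_mono) auto
    then have "int (?c y) \<le> int (card (F2 n))"
      by (simp only: of_nat_le_iff)
    then show ?thesis
      using True by (simp add: B_def)
  next
    case False
    then have "?c y \<le> 2"
      using \<open>APN n F\<close> h that by (auto simp: APN_def)
    then show ?thesis
      using False by (simp add: B_def)
  qed
  have "(\<Sum>x\<in>F2 n. 1 :: int) = (\<Sum>y\<in>F2 n. int (?c y) * 1)"
    using F h by (intro sum_fun_comp) (auto intro!: add_carrier_vec)
  then have total: "(\<Sum>y\<in>F2 n. int (?c y)) = 2 ^ n"
    by simp
  have "(\<Sum>y\<in>F2 n. (int (?c y))\<^sup>2) \<le> (\<Sum>y\<in>F2 n. B * int (?c y))"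
    unfolding power2_eq_square by (intro sum_mono mult_right_mono B) auto
  also have "\<dots> = B * 2 ^ n"
    by (simp add: total flip: sum_distrib_left)
  finally show ?thesis
    by (auto simp: B_def power2_eq_square)
qed

lemma APN_fourth_moment_le:
  assumes "APN n F"
  shows "(\<Sum>b\<in>F2 n - {0\<^sub>v n}. fourth_moment n (component b F)) \<le> 2 * (2 ^ n) ^ 3 * (2 ^ n - 1)"
proof -
  let ?M = "\<lambda>b. fourth_moment n (component b F)" and ?N = "2 ^ n :: int"
  have F: "F \<in> F2 n \<rightarrow> F2 n"
    using assms by (simp add: APN_def)
  have "(\<Sum>b\<in>F2 n. ?M b) \<le> ?N\<^sup>2 * (\<Sum>h\<in>F2 n. if h = 0\<^sub>v n then ?N\<^sup>2 else 2 * ?N)"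
    unfolding sum_fourth_moments[OF F]
    by (intro mult_left_mono sum_mono APN_sum_derivative_counts_le assms) auto
  also have "(\<Sum>h\<in>F2 n. if h = 0\<^sub>v n then ?N\<^sup>2 else 2 * ?N) = ?N\<^sup>2 + (?N - 1) * (2 * ?N)"
    by (subst sum.remove[of _ "0\<^sub>v n"]) (simp_all add: of_nat_diff)
  finally have "?M (0\<^sub>v n) + (\<Sum>b\<in>F2 n - {0\<^sub>v n}. ?M b) \<le> ?N\<^sup>2 * (?N\<^sup>2 + (?N - 1) * (2 * ?N))"
    by (subst (asm) sum.remove[of _ "0\<^sub>v n"]) simp_all
  also have "\<dots> = ?N ^ 4 + 2 * ?N ^ 3 * (?N - 1)"
    by (simp add: algebra_simps power2_eq_square power3_eq_cube power4_eq_xxxx)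
  finally show ?thesis
    using fourth_moment_component_zero[OF F] by linarith
qed

section \<open>Linearity and the number of nonplateaued components\<close>

lemma linearity_attained:
  assumes "n > 0"
  obtains a b where "a \<in> F2 n" "b \<in> F2 n - {0\<^sub>v n}" "linearity n F = \<bar>walsh n (component b F) a\<bar>"
proof -
  let ?A = "{\<bar>walsh n (component b F) a\<bar> | a b. a \<in> F2 n \<and> b \<in> F2 n - {0\<^sub>v n}}"
  have A: "?A = (\<lambda>(a, b). \<bar>walsh n (component b F) a\<bar>) ` (F2 n \<times> (F2 n - {0\<^sub>v n}))"
    by auto
  have "(unit_vec n 0 :: bit vec) \<noteq> 0\<^sub>v n"
    using assms by (metis index_unit_vec(1) index_zero_vec(1) zero_neq_one)
  then have "(0\<^sub>v n, unit_vec n 0) \<in> F2 n \<times> (F2 n - {0\<^sub>v n})"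
    by simp
  then have "Max ?A \<in> ?A"
    unfolding A by (intro Max_in) (simp, blast)
  then show ?thesis
    using that unfolding linearity_def by auto
qed

text \<open>
  The component attaining the linearity \<open>L\<close> has moment at least \<open>L ^ 4\<close>. Each of the other
  \<open>2 ^ n - 2\<close> components is charged \<open>2 * (2 ^ n) ^ 3\<close>, with a discount of \<open>(2 ^ n) ^ 3\<close> if it
  is nonplateaued; the APN bound on the total then forces many discounts.
\<close>
lemma linearity_le_num_nonplateaued:
  assumes "odd n" and apn: "APN n F"
  shows "linearity n F ^ 4 - 2 * (2 ^ n) ^ 3 \<le> (2 ^ n) ^ 3 * int (num_nonplateaued n F)"
proof -
  let ?M = "\<lambda>b. fourth_moment n (component b F)" and ?N = "2 ^ n :: int"
  let ?np = "\<lambda>b. \<not> plateaued n (component b F)"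
  have "n > 0"
    using \<open>odd n\<close> by (cases n) auto
  then obtain a b where ab: "a \<in> F2 n" "b \<in> F2 n - {0\<^sub>v n}"
      and L: "linearity n F = \<bar>walsh n (component b F) a\<bar>"
    by (rule linearity_attained)
  define S where "S = F2 n - {0\<^sub>v n} - {b}"
  have card_S: "int (card S) = ?N - 2"
  proof -
    have "card (F2 n - {0\<^sub>v n}) = Suc (card S)"
      unfolding S_def using ab(2) by (intro card.remove) auto
    moreover have "card (F2 n) = Suc (card (F2 n - {0\<^sub>v n}))"
      by (intro card.remove) auto
    ultimately have "int (card (F2 n)) = int (card S) + 2"
      by simp
    then show ?thesis by simp
  qed
  have "linearity n F ^ 4 \<le> ?M b"
    using walsh_le_fourth_moment[OF ab(1), of "component b F"] by (simp add: L)
  moreover have "?M b + (\<Sum>c\<in>S. ?M c) \<le> 2 * ?N ^ 3 * (?N - 1)"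
    using APN_fourth_moment_le[OF apn] ab(2) unfolding S_def
    by (subst (asm) sum.remove[of _ b]) simp_all
  moreover have "(\<Sum>c\<in>S. ?N ^ 3 * (2 - of_bool (?np c))) \<le> (\<Sum>c\<in>S. ?M c)"
  proof (intro sum_mono)
    fix c
    show "?N ^ 3 * (2 - of_bool (?np c)) \<le> ?M c"
      using fourth_moment_ge[of n "component c F"]
        plateaued_fourth_moment_ge[OF \<open>odd n\<close>, of "component c F"]
      by (auto simp: mult.commute)
  qed
  moreover have "(\<Sum>c\<in>S. ?N ^ 3 * (2 - of_bool (?np c)))
      = 2 * ?N ^ 3 * (?N - 1) - 2 * ?N ^ 3 - ?N ^ 3 * int (card {c \<in> S. ?np c})"
  proof -
    have "(\<Sum>c\<in>S. of_bool (?np c) :: int) = int (card {c \<in> S. ?np c})"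
      by (simp add: S_def Int_def)
    then have "(\<Sum>c\<in>S. ?N ^ 3 * (2 - of_bool (?np c)))
        = ?N ^ 3 * (2 * int (card S) - int (card {c \<in> S. ?np c}))"
      by (simp add: sum_subtractf flip: sum_distrib_left)
    then show ?thesis
      unfolding card_S by (simp add: right_diff_distrib)
  qed
  moreover have "?N ^ 3 * int (card {c \<in> S. ?np c}) \<le> ?N ^ 3 * int (num_nonplateaued n F)"
  proof -
    have "card {c \<in> S. ?np c} \<le> num_nonplateaued n F"
      unfolding num_nonplateaued_def S_def by (intro card_mono) auto
    then show ?thesis
      by (intro mult_left_mono) auto
  qed
  ultimately show ?thesis
    by linarith
qed

lemma num_nonplateaued_le: "num_nonplateaued n F \<le> 2 ^ n"
proof -
  have "num_nonplateaued n F \<le> card (F2 n)"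
    unfolding num_nonplateaued_def by (intro card_mono) auto
  then show ?thesis by simp
qed

lemma num_nonplateaued_ratio_ge:
  assumes "odd n" "APN n F"
  shows "(real_of_int (linearity n F) / 2 ^ n) ^ 4 - 2 / 2 ^ n \<le> real (num_nonplateaued n F) / 2 ^ n"
proof -
  let ?N = "2 ^ n :: real"
  have "real_of_int (linearity n F ^ 4 - 2 * (2 ^ n) ^ 3)
      \<le> real_of_int ((2 ^ n) ^ 3 * int (num_nonplateaued n F))"
    using linearity_le_num_nonplateaued[OF assms] by (simp only: of_int_le_iff)
  then have "real_of_int (linearity n F) ^ 4 - 2 * ?N ^ 3 \<le> ?N ^ 3 * real (num_nonplateaued n F)"
    by simp
  then have "(real_of_int (linearity n F) ^ 4 - 2 * ?N ^ 3) / ?N ^ 4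
      \<le> (?N ^ 3 * real (num_nonplateaued n F)) / ?N ^ 4"
    by (rule divide_right_mono) simp
  moreover have "?N ^ 4 = ?N ^ 3 * ?N"
    by (simp add: power3_eq_cube power4_eq_xxxx)
  ultimately show ?thesis
    by (simp add: diff_divide_distrib power_divide)
qed

theorem mainTheorem4:
  fixes d :: "nat \<Rightarrow> nat" and F :: "nat \<Rightarrow> bit vec \<Rightarrow> bit vec"
  assumes "\<And>k. odd (d k)"
    and "filterlim d at_top sequentially"
    and "\<And>k. APN (d k) (F k)"
    and "(\<lambda>k. real_of_int (linearity (d k) (F k)) / 2 ^ d k) \<longlonglongrightarrow> 1"
  shows "(\<lambda>k. real (num_nonplateaued (d k) (F k)) / 2 ^ d k) \<longlonglongrightarrow> 1"
proof (rule tendsto_sandwich)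
  let ?lower = "\<lambda>k. (real_of_int (linearity (d k) (F k)) / 2 ^ d k) ^ 4 - 2 / 2 ^ d k"
  show "\<forall>\<^sub>F k in sequentially. ?lower k \<le> real (num_nonplateaued (d k) (F k)) / 2 ^ d k"
    using num_nonplateaued_ratio_ge assms by simp
  have "real (num_nonplateaued (d k) (F k)) \<le> 2 ^ d k" for k
    using num_nonplateaued_le[of "d k" "F k"] by (metis of_nat_le_iff of_nat_numeral of_nat_power)
  then show "\<forall>\<^sub>F k in sequentially. real (num_nonplateaued (d k) (F k)) / 2 ^ d k \<le> 1"
    by simp
  have "(\<lambda>m. 2 / 2 ^ m :: real) \<longlonglongrightarrow> 0"
    by real_asymp
  then have "(\<lambda>k. 2 / 2 ^ d k :: real) \<longlonglongrightarrow> 0"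
    using assms(2) by (rule filterlim_compose)
  from tendsto_diff[OF tendsto_power[OF assms(4), of 4] this] show "?lower \<longlonglongrightarrow> 1"
    by simp
qed simp

end
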